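(* Let $|q|<1$ and $x\in\mathbb{C}^*$ such that all quantities below are defined. Then \[ j\bigl(xq;q^2\bigr)R_c\bigl(x,q^2\bigr)-\bigl(1-x^{-1}\bigr)q\,j\bigl(x;q^2\bigr)g_{3,c}\bigl(xq,q^2\bigr)=\frac{(1-x)J_1^5}{J_2^2\,j(x;q)}. \]
   Context: For $n\in\mathbb{Z}\cup\{\infty\}$: $(a;q)_\infty=\prod_{j\ge0}(1-aq^j)$, $(a;q)_n=(a;q)_\infty/(aq^n;q)_\infty$ (also for negative $n$), $(a_1,\dots,a_m;q)_n=\prod_i(a_i;q)_n$. $j(z;q)=(z,q/z,q;q)_\infty$, $J_m=(q^m;q^m)_\infty$. Bilateral series: $R_c(x,q)=\sum_{n=-\infty}^\infty\frac{q^{n^2}}{(xq,q/x;q)_n}$ and $g_{3,c}(x,q)=\sum_{n=-\infty}^{\infty}\frac{q^{n^2+n}}{(x,q/x;q)_{n+1}}$. *)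

theory Defs
  imports "HOL-Analysis.Analysis"
begin

definition qpoch_inf :: "complex \<Rightarrow> complex \<Rightarrow> complex" where
  "qpoch_inf a q = (\<Prod>j. 1 - a * q ^ j)"

(* For negative n this is only meaningful when q is nonzero and the denominator
   does not vanish. *)
definition qpoch :: "complex \<Rightarrow> complex \<Rightarrow> int \<Rightarrow> complex" where
  "qpoch a q n = qpoch_inf a q / qpoch_inf (a * q powi n) q"

definition jtheta :: "complex \<Rightarrow> complex \<Rightarrow> complex" where
  "jtheta z q = qpoch_inf z q * qpoch_inf (q / z) q * qpoch_inf q q"

(* The base q, implicit in the usual notation J_m, is an explicit argument. *)
definition J :: "nat \<Rightarrow> complex \<Rightarrow> complex" where
  "J m q = qpoch_inf (q ^ m) (q ^ m)"

definition R_c :: "complex \<Rightarrow> complex \<Rightarrow> complex" where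
  "R_c x q = (\<Sum>\<^sub>\<infinity>n\<in>(UNIV :: int set).
     q powi (n\<^sup>2) / (qpoch (x * q) q n * qpoch (q / x) q n))"

definition g3_c :: "complex \<Rightarrow> complex \<Rightarrow> complex" where
  "g3_c x q = (\<Sum>\<^sub>\<infinity>n\<in>(UNIV :: int set).
     q powi (n\<^sup>2 + n) / (qpoch x q (n + 1) * qpoch (q / x) q (n + 1)))"

end

theory Submission
  imports Defs "HOL-Complex_Analysis.Complex_Analysis"
begin

text \<open>
  Write \<open>Q = q\<^sup>2\<close>, \<open>T(x) = j(x;Q)\<close> and \<open>P(a) = (a;Q)\<^sub>\<infinity>\<close>. Multiplying the bilateral series by the
  infinite products in their denominators gives functions \<open>E(x)\<close> (from \<open>R\<^sub>c(x,Q)\<close>) and \<open>G(x)\<close>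
  (from \<open>g\<^sub>3\<^sub>,\<^sub>c(xq,Q)\<close>) that are holomorphic for \<open>x \<noteq> 0\<close>. Telescoping yields
  \<open>E(xq) = qx G(x) + \<lambda>(x)\<close> and \<open>E(x/q) = (q/x) G(x) + \<lambda>(x)\<close>, where \<open>\<lambda>(x) = T(xq)\<^sup>2 / P(Q)\<^sup>2\<close>.
  The left-hand side of the theorem is then
  \<open>(1 - x) P(Q) N(x) / (T(x) T(xq))\<close> with \<open>N(x) = T(xq)\<^sup>2 E(x) + x\<^sup>-\<^sup>2 T(x)\<^sup>2 (E(xq) - \<lambda>(x))\<close>.
  The two functional equations give \<open>N(xq) = N(x)\<close>, so \<open>N\<close> is constant by Liouville's theorem.
  Since \<open>T(1) = 0\<close>, its value is \<open>T(q)\<^sup>2 E(1)\<close>, and \<open>E(1) = P(Q)\<close> is the Durfee square identity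
  \<open>\<Sum> Q^(n\<^sup>2) / (Q;Q)\<^sub>n\<^sup>2 = 1 / (Q;Q)\<^sub>\<infinity>\<close>.
\<close>

subsection \<open>Infinite q-Pochhammer symbols\<close>

lemma convergent_prod_qpoch:
  fixes q a :: complex
  assumes "norm q < 1"
  shows "convergent_prod (\<lambda>j. 1 - a * q ^ j)"
proof -
  have "summable (\<lambda>j. norm a * norm q ^ j)"
    using assms by (intro summable_mult summable_geometric) auto
  then have "summable (\<lambda>j. norm ((1 - a * q ^ j) - 1))"
    by (simp add: norm_mult norm_power)
  then show ?thesis
    by (intro abs_convergent_prod_imp_convergent_prod summable_imp_abs_convergent_prod)
qed

lemma qpoch_inf_LIMSEQ:
  assumes "norm q < 1"
  shows "(\<lambda>n. \<Prod>j<n. 1 - a * q ^ j) \<longlonglongrightarrow> qpoch_inf a q"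
proof -
  have "(\<lambda>n. \<Prod>j\<le>n. 1 - a * q ^ j) \<longlonglongrightarrow> qpoch_inf a q"
    unfolding qpoch_inf_def by (rule convergent_prod_LIMSEQ[OF convergent_prod_qpoch[OF assms]])
  then have "(\<lambda>n. \<Prod>j<Suc n. 1 - a * q ^ j) \<longlonglongrightarrow> qpoch_inf a q"
    by (simp add: lessThan_Suc_atMost)
  then show ?thesis
    by (rule filterlim_sequentially_Suc[THEN iffD1])
qed

lemma qpoch_inf_rec:
  assumes "norm q < 1"
  shows "qpoch_inf a q = (1 - a) * qpoch_inf (a * q) q"
proof -
  have "(\<lambda>n. \<Prod>j<Suc n. 1 - a * q ^ j) \<longlonglongrightarrow> qpoch_inf a q"
    using qpoch_inf_LIMSEQ[OF assms] by (rule filterlim_sequentially_Suc[THEN iffD2])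
  moreover have "(\<Prod>j<Suc n. 1 - a * q ^ j) = (1 - a) * (\<Prod>j<n. 1 - (a * q) * q ^ j)" for n
    by (subst prod.lessThan_Suc_shift) (simp add: mult.assoc)
  ultimately have "(\<lambda>n. (1 - a) * (\<Prod>j<n. 1 - (a * q) * q ^ j)) \<longlonglongrightarrow> qpoch_inf a q"
    by simp
  moreover have "(\<lambda>n. (1 - a) * (\<Prod>j<n. 1 - (a * q) * q ^ j)) \<longlonglongrightarrow> (1 - a) * qpoch_inf (a * q) q"
    by (intro tendsto_mult_left qpoch_inf_LIMSEQ assms)
  ultimately show ?thesis
    by (rule LIMSEQ_unique)
qed

lemma qpoch_inf_0 [simp]: "qpoch_inf 0 q = 1"
  by (simp add: qpoch_inf_def)

lemma qpoch_inf_1 [simp]: "norm q < 1 \<Longrightarrow> qpoch_inf 1 q = 0"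
  by (subst qpoch_inf_rec) auto

text \<open>Factors of even and of odd index are collected separately. This is how a theta function
  to the base q is expressed through products to the base q^2.\<close>

lemma qpoch_inf_split:
  assumes "norm q < 1"
  shows "qpoch_inf a q = qpoch_inf a (q\<^sup>2) * qpoch_inf (a * q) (q\<^sup>2)"
proof -
  have q2: "norm (q\<^sup>2) < 1"
    using assms by (simp add: norm_power power_less_one_iff)
  have eq: "(\<Prod>j<2 * n. 1 - a * q ^ j)
      = (\<Prod>j<n. 1 - a * (q\<^sup>2) ^ j) * (\<Prod>j<n. 1 - (a * q) * (q\<^sup>2) ^ j)" for n
    by (induction n) (simp_all add: power_mult [symmetric] mult_ac)
  have "(\<lambda>n. \<Prod>j<2 * n. 1 - a * q ^ j) \<longlonglongrightarrow> qpoch_inf a q"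
    using qpoch_inf_LIMSEQ[OF assms]
    by (rule filterlim_compose) (auto intro!: filterlim_subseq simp: strict_mono_def)
  moreover have "(\<lambda>n. \<Prod>j<2 * n. 1 - a * q ^ j)
      \<longlonglongrightarrow> qpoch_inf a (q\<^sup>2) * qpoch_inf (a * q) (q\<^sup>2)"
    unfolding eq by (intro tendsto_mult qpoch_inf_LIMSEQ q2)
  ultimately show ?thesis
    by (rule LIMSEQ_unique)
qed

text \<open>From \<open>1 + t \<le> exp t\<close> and the geometric series. The bound is uniform in
  \<open>n\<close>, so it serves both for the infinite product and for the finite products that come
  from negative indices.\<close>

lemma norm_qpoch_prod_le:
  fixes q a :: complex
  assumes "norm q < 1"
  shows "norm (\<Prod>j<n. 1 - a * q ^ j) \<le> exp (norm a / (1 - norm q))"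
proof -
  have "norm (\<Prod>j<n. 1 - a * q ^ j) \<le> (\<Prod>j<n. exp (norm a * norm q ^ j))"
    unfolding prod_norm [symmetric]
  proof (intro prod_mono conjI)
    fix j
    have "norm (1 - a * q ^ j) \<le> 1 + norm a * norm q ^ j"
      using norm_triangle_ineq4[of 1 "a * q ^ j"] by (simp add: norm_mult norm_power)
    also have "\<dots> \<le> exp (norm a * norm q ^ j)"
      by simp
    finally show "norm (1 - a * q ^ j) \<le> exp (norm a * norm q ^ j)" .
  qed auto
  also have "\<dots> = exp (norm a * (\<Sum>j<n. norm q ^ j))"
    by (simp add: exp_sum sum_distrib_left)
  also have "\<dots> \<le> exp (norm a * (1 / (1 - norm q)))"
  proof -
    have "(\<Sum>j<n. norm q ^ j) \<le> (\<Sum>j. norm q ^ j)"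
      using assms by (intro sum_le_suminf summable_geometric) auto
    then show ?thesis
      using assms by (simp add: suminf_geometric mult_left_mono del: times_divide_eq_right)
  qed
  finally show ?thesis by simp
qed

lemma norm_qpoch_inf_le:
  assumes "norm q < 1"
  shows "norm (qpoch_inf a q) \<le> exp (norm a / (1 - norm q))"
  by (rule tendsto_upperbound[OF tendsto_norm[OF qpoch_inf_LIMSEQ[OF assms]]])
     (auto intro!: always_eventually norm_qpoch_prod_le assms)

text \<open>The partial products are polynomials in \<open>a\<close>; by the M-test they converge
  uniformly on every closed disc of radius 1.\<close>

lemma holomorphic_qpoch_inf [holomorphic_intros]:
  assumes "norm q < 1"
  shows "(\<lambda>a. qpoch_inf a q) holomorphic_on A"
proof -
  have "(\<lambda>a. qpoch_inf a q) holomorphic_on UNIV"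
  proof (rule holomorphic_uniform_sequence)
    show "(\<lambda>a. \<Prod>j<n. 1 - a * q ^ j) holomorphic_on UNIV" for n
      by (intro holomorphic_intros)
    fix z :: complex
    let ?C = "cball z 1"
    have "uniformly_convergent_on ?C (\<lambda>n a. \<Sum>j<n. norm ((1 - a * q ^ j) - 1))"
    proof (rule Weierstrass_m_test')
      show "norm (norm ((1 - a * q ^ j) - 1)) \<le> (norm z + 1) * norm q ^ j" if "a \<in> ?C" for j a
      proof -
        have "norm a \<le> norm z + 1"
          using that norm_triangle_ineq2[of a z] by (simp add: dist_norm norm_minus_commute)
        then show ?thesis
          by (simp add: norm_mult norm_power mult_right_mono)
      qed
      show "summable (\<lambda>j. (norm z + 1) * norm q ^ j)"
        using assms by (intro summable_mult summable_geometric) auto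
    qed
    then have "uniformly_convergent_on ?C (\<lambda>n a. \<Prod>j<n. 1 - a * q ^ j)"
      by (intro uniformly_convergent_on_prod' continuous_intros) auto
    then have ul: "uniform_limit ?C (\<lambda>n a. \<Prod>j<n. 1 - a * q ^ j)
                 (\<lambda>a. lim (\<lambda>n. \<Prod>j<n. 1 - a * q ^ j)) sequentially"
      by (simp add: uniformly_convergent_uniform_limit_iff)
    have "uniform_limit ?C (\<lambda>n a. \<Prod>j<n. 1 - a * q ^ j) (\<lambda>a. qpoch_inf a q) sequentially"
      using ul limI[OF qpoch_inf_LIMSEQ[OF assms]] by simp
    then show "\<exists>d. 0 < d \<and> cball z d \<subseteq> UNIV \<and>
        uniform_limit (cball z d) (\<lambda>n a. \<Prod>j<n. 1 - a * q ^ j) (\<lambda>a. qpoch_inf a q) sequentially"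
      by (intro exI[of _ 1]) auto
  qed auto
  then show ?thesis
    by (rule holomorphic_on_subset) auto
qed

lemma tendsto_qpoch_inf [tendsto_intros]:
  assumes "norm q < 1" "(f \<longlongrightarrow> l) F"
  shows "((\<lambda>x. qpoch_inf (f x) q) \<longlongrightarrow> qpoch_inf l q) F"
proof -
  have "continuous_on UNIV (\<lambda>a. qpoch_inf a q)"
    using assms(1) by (intro holomorphic_on_imp_continuous_on holomorphic_qpoch_inf)
  then show ?thesis
    using assms(2) by (rule continuous_on_tendsto_compose) auto
qed

text \<open>Each new factor 1 - X q^(-j) equals -X q^(-j) (1 - q^j / X). With two parameters the
  signs cancel and the powers q^(-j) collect to q^(-m(m+1)), of which q^(m^2) leaves only q^(-m).
  Terms of negative index thus become a power times bounded products.\<close>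

lemma qpoch_inf_powi_uminus:
  fixes q X Y :: complex
  assumes "norm q < 1" "q \<noteq> 0" "X \<noteq> 0" "Y \<noteq> 0"
  shows "q ^ (m\<^sup>2) * (qpoch_inf (X * q powi - int m) q * qpoch_inf (Y * q powi - int m) q)
    = (X * Y / q) ^ m * ((\<Prod>k<m. 1 - q / X * q ^ k) * (\<Prod>k<m. 1 - q / Y * q ^ k))
      * (qpoch_inf X q * qpoch_inf Y q)"
proof (induction m)
  case (Suc m)
  have rec: "qpoch_inf (Z * q powi - int (Suc m)) q
      = (1 - Z / q ^ Suc m) * qpoch_inf (Z * q powi - int m) q" for Z
  proof -
    have "Z * q powi - int (Suc m) = Z / q ^ Suc m"
      by (subst power_int_minus, subst power_int_of_nat) (simp add: field_simps)
    moreover have "Z * q powi - int m = Z / q ^ Suc m * q"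
      using assms by (simp add: power_int_minus field_simps)
    ultimately show ?thesis
      using qpoch_inf_rec[OF assms(1)] by metis
  qed
  have fac: "q ^ (2 * m + 1) * ((1 - X / q ^ Suc m) * (1 - Y / q ^ Suc m))
      = X * Y / q * ((1 - q / X * q ^ m) * (1 - q / Y * q ^ m))"
  proof -
    have "q ^ (2 * m + 1) = q * q ^ m * q ^ m"
      by (simp add: power_add mult_2)
    then show ?thesis
      using assms by (simp add: field_simps)
  qed
  have "q ^ ((Suc m)\<^sup>2) * (qpoch_inf (X * q powi - int (Suc m)) q * qpoch_inf (Y * q powi - int (Suc m)) q)
     = (q ^ (2 * m + 1) * ((1 - X / q ^ Suc m) * (1 - Y / q ^ Suc m)))
       * (q ^ (m\<^sup>2) * (qpoch_inf (X * q powi - int m) q * qpoch_inf (Y * q powi - int m) q))"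
  proof -
    have "q ^ ((Suc m)\<^sup>2) = q ^ (2 * m + 1) * q ^ (m\<^sup>2)"
    proof -
      have "(Suc m)\<^sup>2 = (2 * m + 1) + m\<^sup>2"
        by (simp add: power2_eq_square)
      then show ?thesis
        by (simp only: power_add)
    qed
    then show ?thesis
      unfolding rec by (simp only: mult_ac)
  qed
  also have "\<dots> = (X * Y / q) ^ Suc m * ((\<Prod>k<Suc m. 1 - q / X * q ^ k) * (\<Prod>k<Suc m. 1 - q / Y * q ^ k))
      * (qpoch_inf X q * qpoch_inf Y q)"
    unfolding Suc.IH fac by (simp add: mult_ac)
  finally show ?case .
qed simp

text \<open>The identity is the case k = 0 of a family over Durfee rectangles of sides n and n + k.
  The sums \<open>S k\<close> of that family do not depend on \<open>k\<close>, and their limit as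
  \<open>k\<close> grows is (q;q)_inf.\<close>

lemma qpoch_inf_durfee:
  fixes q :: complex
  assumes q: "norm q < 1"
  shows "(\<Sum>n. q ^ (n\<^sup>2) * (qpoch_inf (q * q ^ n) q)\<^sup>2) = qpoch_inf q q"
proof -
  define P where "P a = qpoch_inf a q" for a
  define K where "K = exp (1 / (1 - norm q))"
  define U where "U k n = q ^ (n\<^sup>2 + k * n) * (P (q ^ Suc n) * P (q ^ (Suc n + k)))" for k n
  define S where "S k = suminf (U k)" for k
  have P_le: "norm (P (q ^ j)) \<le> K" for j
  proof -
    have "norm (P (q ^ j)) \<le> exp (norm (q ^ j) / (1 - norm q))"
      unfolding P_def by (rule norm_qpoch_inf_le[OF q])
    also have "\<dots> \<le> K"
      unfolding K_def using q by (auto simp: norm_power power_le_one intro!: divide_right_mono)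
    finally show ?thesis .
  qed
  have K: "K \<ge> 0" by (simp add: K_def)
  have U_le: "norm (U k n) \<le> (K * K) * norm q ^ n" for k n
  proof -
    have "n \<le> n\<^sup>2 + k * n"
      by (simp add: power2_nat_le_imp_le power2_eq_square trans_le_add1)
    then have "norm q ^ (n\<^sup>2 + k * n) \<le> norm q ^ n"
      using q by (intro power_decreasing) auto
    then have "norm (U k n) \<le> norm q ^ n * (K * K)"
      unfolding U_def norm_mult norm_power using K
      by (intro mult_mono P_le mult_nonneg_nonneg) auto
    then show ?thesis by (simp add: mult_ac)
  qed
  have sumM: "summable (\<lambda>n. (K * K) * norm q ^ n)"
    using q by (intro summable_mult summable_geometric) auto
  have sumU: "summable (U k)" for k
    by (rule summable_comparison_test'[OF sumM]) (rule U_le)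
  have rec: "P a = (1 - a) * P (a * q)" for a
    unfolding P_def by (rule qpoch_inf_rec[OF q])
  \<comment> \<open>By this recurrence, the moduli of the consecutive differences increase with \<^term>\<open>k\<close>, while they tend to
    zero, so the sequence \<^term>\<open>S\<close> is constant.\<close>
  have step: "S k - S (Suc k) = q ^ Suc k * (S (Suc (Suc k)) - S (Suc k))" for k
  proof -
    \<comment> \<open>\<open>V\<close> carries the factor 1 - q^n inside \<open>P (q ^ n)\<close>,
      so it vanishes at n = 0. Shifting its index by one gives a multiple of
      \<open>U (Suc (Suc k))\<close>, which closes the recurrence.\<close>
    define V where "V n = q ^ (n\<^sup>2 + k * n) * (P (q ^ n) * P (q ^ (n + k + 2)))" for n
    have diff: "U k n - U (Suc k) n = V n - q ^ Suc k * U (Suc k) n" for n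
    proof -
      have 1: "P (q ^ n) = (1 - q ^ n) * P (q ^ Suc n)"
        using rec[of "q ^ n"] by (simp add: mult_ac)
      have 2: "P (q ^ (Suc n + k)) = (1 - q ^ (Suc n + k)) * P (q ^ (n + k + 2))"
        using rec[of "q ^ (Suc n + k)"] by (simp add: mult_ac)
      show ?thesis
        unfolding U_def V_def 1 2 by (simp add: power_add algebra_simps)
    qed
    have V_Suc: "V (Suc n) = q ^ Suc k * U (Suc (Suc k)) n" for n
      unfolding V_def U_def by (simp add: power_add power2_eq_square algebra_simps)
    have "V 0 = 0"
      by (simp add: V_def P_def q)
    have sumV': "summable (\<lambda>n. V (Suc n))"
      unfolding V_Suc by (intro summable_mult sumU)
    then have sumV: "summable V"
      by (simp add: summable_Suc_iff)
    have "S k - S (Suc k) = (\<Sum>n. U k n - U (Suc k) n)"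
      unfolding S_def by (intro suminf_diff sumU)
    also have "\<dots> = suminf V - q ^ Suc k * S (Suc k)"
      unfolding S_def diff using sumV sumU
      by (subst suminf_diff[symmetric]) (auto intro!: summable_mult simp: suminf_mult)
    also have "suminf V = q ^ Suc k * S (Suc (Suc k))"
      using suminf_split_head[OF sumV] \<open>V 0 = 0\<close> sumU
      by (simp add: V_Suc S_def suminf_mult del: power_Suc)
    finally show ?thesis by (simp add: algebra_simps)
  qed
  \<comment> \<open>The factor q^(k n) kills every term except n = 0 as \<open>k\<close> grows; the
    bound \<open>U_le\<close>, independent of \<open>k\<close>, permits the termwise limit.\<close>
  have lim: "S \<longlonglongrightarrow> P q"
  proof -
    have q_lim: "(\<lambda>k. q ^ k) \<longlonglongrightarrow> 0"
      using q by (rule LIMSEQ_power_zero)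
    have "(\<lambda>k. U k n) \<longlonglongrightarrow> (if n = 0 then P q else 0)" for n
    proof -
      have "(\<lambda>k. P (q ^ Suc n * q ^ k)) \<longlonglongrightarrow> P (q ^ Suc n * 0)"
        unfolding P_def using q q_lim by (intro tendsto_intros)
      then have P_lim: "(\<lambda>k. P (q ^ Suc n) * P (q ^ (Suc n + k))) \<longlonglongrightarrow> P (q ^ Suc n) * 1"
        by (intro tendsto_mult_left) (simp add: power_add P_def mult.assoc)
      have "(\<lambda>k. q ^ (n\<^sup>2 + k * n)) \<longlonglongrightarrow> (if n = 0 then 1 else 0)"
      proof (cases "n = 0")
        case False
        then have "(\<lambda>k. q ^ (n\<^sup>2) * (q ^ n) ^ k) \<longlonglongrightarrow> q ^ (n\<^sup>2) * 0"
          using q by (intro tendsto_mult_left LIMSEQ_power_zero) (simp add: norm_power power_less_one_iff)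
        then show ?thesis
          using False by (simp add: power_add power_mult mult.commute[of _ n])
      qed simp
      from tendsto_mult[OF this P_lim] show ?thesis
        unfolding U_def by (cases "n = 0") simp_all
    qed
    then have "eventually (\<lambda>k. summable (\<lambda>n. norm (U k n))) sequentially \<and>
        summable (\<lambda>n. norm (if n = 0 then P q else 0)) \<and>
        (\<lambda>k. suminf (U k)) \<longlonglongrightarrow> (\<Sum>n. if n = 0 then P q else 0)"
      by (rule tannerys_theorem[OF _ always_eventually sumM]) (auto intro: U_le)
    then show ?thesis
      using sums_unique[OF sums_single[of 0 "\<lambda>_. P q"]] by (simp add: S_def [abs_def])
  qed
  have "S k = S (Suc k)" for k
  proof -
    define D where "D k = norm (S k - S (Suc k))" for k
    have "incseq D"
    proof (rule incseq_SucI)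
      fix k
      have "D k = norm q ^ Suc k * D (Suc k)"
        unfolding D_def using step[of k] by (simp only: norm_mult norm_power norm_minus_commute)
      also have "\<dots> \<le> 1 * D (Suc k)"
        using q by (intro mult_right_mono power_le_one) (auto simp: D_def)
      finally show "D k \<le> D (Suc k)" by simp
    qed
    moreover have "D \<longlonglongrightarrow> norm (P q - P q)"
      unfolding D_def by (intro tendsto_intros lim filterlim_sequentially_Suc[THEN iffD2])
    ultimately have "D k \<le> norm (P q - P q)"
      by (rule incseq_le)
    then show ?thesis by (simp add: D_def)
  qed
  then have "S k = S 0" for k
    by (induction k) auto
  then have "S = (\<lambda>_. S 0)"
    by (rule ext)
  then have "S \<longlonglongrightarrow> S 0"
    using tendsto_const[of "S 0" sequentially] by metis
  then have "S 0 = P q"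
    using lim by (rule LIMSEQ_unique)
  then show ?thesis
    by (simp add: S_def U_def [abs_def] P_def power2_eq_square)
qed

subsection \<open>Sums over the integers\<close>

lemma summable_on_power_nat_abs:
  fixes r :: real
  assumes "0 \<le> r" "r < 1"
  shows "(\<lambda>n::int. r ^ nat \<bar>n\<bar>) summable_on UNIV"
proof -
  have s: "(\<lambda>n::nat. r ^ n) summable_on UNIV"
    using assms by (intro norm_summable_imp_summable_on) (simp add: summable_geometric)
  have "(\<lambda>n. r ^ nat \<bar>n\<bar>) summable_on range int"
    by (subst summable_on_reindex) (auto simp: o_def s)
  moreover have "(\<lambda>n. r ^ nat \<bar>n\<bar>) summable_on range (\<lambda>n. - int n)"
    by (subst summable_on_reindex) (auto simp: o_def s inj_on_def)
  moreover have "UNIV = range int \<union> range (\<lambda>n. - int n)"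
  proof -
    have "n \<in> range int \<union> range (\<lambda>n. - int n)" for n
      by (cases n rule: int_cases2) auto
    then show ?thesis by blast
  qed
  ultimately show ?thesis
    using summable_on_union by metis
qed

text \<open>Every finite set of integers lies in some interval \<open>{- int N..<int N}\<close>. The
  interval is half-open so that telescoping sums end exactly at -N and N.\<close>

lemma has_sum_int_imp_LIMSEQ:
  fixes f :: "int \<Rightarrow> 'a :: {topological_comm_monoid_add, t2_space}"
  assumes "(f has_sum S) UNIV"
  shows "(\<lambda>N. sum f {- int N..<int N}) \<longlonglongrightarrow> S"
proof -
  have "filterlim (\<lambda>N. {- int N..<int N}) (finite_subsets_at_top UNIV) sequentially"
    unfolding filterlim_finite_subsets_at_top
  proof (intro allI impI)
    fix X :: "int set"
    assume X: "finite X \<and> X \<subseteq> UNIV"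
    then have "bdd_above (abs ` X)"
      by (intro bdd_above_finite finite_imageI) auto
    then obtain M where M: "\<forall>n\<in>X. \<bar>n\<bar> \<le> M"
      by (auto simp: bdd_above_def)
    show "\<forall>\<^sub>F N in sequentially. finite {- int N..<int N} \<and> X \<subseteq> {- int N..<int N} \<and> {- int N..<int N} \<subseteq> UNIV"
      using eventually_gt_at_top[of "nat M"]
    proof eventually_elim
      case (elim N)
      then show ?case using M by force
    qed
  qed
  then show ?thesis
    using assms unfolding has_sum_def by (rule filterlim_compose[rotated])
qed

lemma has_sum_diff_cmult:
  fixes f g :: "'a \<Rightarrow> complex"
  assumes "(f has_sum a) A" "(g has_sum b) A"
  shows "((\<lambda>x. f x - c * g x) has_sum (a - c * b)) A"
  using has_sum_add[OF assms(1) has_sum_cmult_right[OF assms(2), of "- c"]] by simp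

text \<open>The partial sum over -N \<le> n < N is d(-N) - d(N), so the boundary value at minus
  infinity survives. Summability guarantees that these particular partial sums determine the full
  sum.\<close>

lemma infsum_int_telescope:
  fixes f d :: "int \<Rightarrow> complex"
  assumes "f summable_on UNIV" and f: "\<And>n. f n = d n - d (n + 1)"
    and "(\<lambda>N. d (- int N)) \<longlonglongrightarrow> l" and "(\<lambda>N. d (int N)) \<longlonglongrightarrow> 0"
  shows "infsum f UNIV = l"
proof -
  have "sum f {- int N..<int N} = d (- int N) - d (int N)" for N
  proof (induction N)
    case (Suc N)
    have "{- int (Suc N)..<int (Suc N)} = insert (- int N - 1) (insert (int N) {- int N..<int N})"
      by auto
    then have "sum f {- int (Suc N)..<int (Suc N)}
        = f (- int N - 1) + (f (int N) + sum f {- int N..<int N})"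
      by simp
    also have "\<dots> = d (- int N - 1) - d (int N + 1)"
      unfolding Suc by (simp add: f)
    also have "- int N - 1 = - int (Suc N)"
      by simp
    also have "int N + 1 = int (Suc N)"
      by simp
    finally show ?case .
  qed simp
  then have "(\<lambda>N. sum f {- int N..<int N}) \<longlonglongrightarrow> l - 0"
    using tendsto_diff[OF assms(3,4)] by simp
  moreover have "(\<lambda>N. sum f {- int N..<int N}) \<longlonglongrightarrow> infsum f UNIV"
    using assms(1) by (intro has_sum_int_imp_LIMSEQ has_sum_infsum)
  ultimately show ?thesis
    using LIMSEQ_unique by fastforce
qed

subsection \<open>Bilateral series\<close>

text \<open>By (a;q)_n = (a;q)_inf / (a q^n;q)_inf, this is a term of a bilateral series with the
  n-independent products removed. The factor \<open>c\<close> allows one treatment of both series: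
  it is 1 for \<open>R_c\<close> and q for \<open>g3_c\<close>.\<close>

definition bilateral_term :: "complex \<Rightarrow> complex \<Rightarrow> complex \<Rightarrow> complex \<Rightarrow> int \<Rightarrow> complex" where
  "bilateral_term q c X Y n =
     c powi n * q powi (n\<^sup>2) * (qpoch_inf (X * q powi n) q * qpoch_inf (Y * q powi n) q)"

text \<open>For n \<ge> 0 the decay comes from q^(n^2). For n = -m, reflection by
  \<open>qpoch_inf_powi_uminus\<close> leaves (XY/(cq))^m times two finite and two infinite
  products, and the condition on XY bounds the ratio by |q|. Both series of interest attain equality
  in that condition. The constant depends on X and Y only through \<open>R\<close>, which makes the
  bound locally uniform.\<close>

lemma norm_bilateral_term_le:
  assumes q: "norm q < 1" "q \<noteq> 0" and nz: "c \<noteq> 0" "X \<noteq> 0" "Y \<noteq> 0"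
    and c: "norm c \<le> 1" "norm (X * Y) \<le> norm (c * q\<^sup>2)"
    and R: "norm X \<le> R" "norm Y \<le> R" "norm (q / X) \<le> R" "norm (q / Y) \<le> R"
  shows "norm (bilateral_term q c X Y n) \<le> exp (R / (1 - norm q)) ^ 4 * norm q ^ nat \<bar>n\<bar>"
proof -
  define K where "K = exp (R / (1 - norm q))"
  have "0 \<le> R"
    using R(1) norm_ge_zero order_trans by blast
  then have K: "1 \<le> K"
    using q by (simp add: K_def)
  have le_K: "exp (norm z / (1 - norm q)) \<le> K" if "norm z \<le> R" for z :: complex
    unfolding K_def using that q by (auto intro!: divide_right_mono)
  have inf_le: "norm (qpoch_inf z q) \<le> K" if "norm z \<le> R" for z :: complex
    using norm_qpoch_inf_le[OF q(1), of z] le_K[OF that] by linarith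
  have prod_le: "norm (\<Prod>j<m. 1 - z * q ^ j) \<le> K" if "norm z \<le> R" for z :: complex and m :: nat
    using norm_qpoch_prod_le[OF q(1), of z m] le_K[OF that] by linarith
  have "norm (bilateral_term q c X Y n) \<le> K ^ 4 * norm q ^ nat \<bar>n\<bar>"
  proof (cases n rule: int_cases2)
    case (nonneg m)
    have shift: "norm (z * q ^ m) \<le> R" if "norm z \<le> R" for z :: complex
    proof -
      have "norm (z * q ^ m) \<le> norm z * 1"
        unfolding norm_mult norm_power using q by (intro mult_left_mono power_le_one) auto
      then show ?thesis using that by simp
    qed
    have "m \<le> m\<^sup>2"
      by (simp add: power2_nat_le_imp_le power2_eq_square)
    then have "norm q ^ (m\<^sup>2) \<le> norm q ^ m"
      using q by (intro power_decreasing) auto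
    then have "norm (bilateral_term q c X Y n) \<le> 1 * norm q ^ m * (K * K)"
      unfolding bilateral_term_def nonneg norm_mult norm_power power_int_of_nat of_nat_power[symmetric]
      using c(1) K q R
      by (intro mult_mono inf_le shift mult_nonneg_nonneg power_le_one) auto
    also have "\<dots> \<le> norm q ^ m * K ^ 4"
      using power_increasing[of 2 4 K] K by (simp add: power2_eq_square mult_left_mono)
    finally show ?thesis
      by (simp add: nonneg mult.commute)
  next
    case (nonpos m)
    define A where "A = (\<Prod>k<m. 1 - q / X * q ^ k) * (\<Prod>k<m. 1 - q / Y * q ^ k)"
    define B where "B = qpoch_inf X q * qpoch_inf Y q"
    have sq: "q powi (n\<^sup>2) = q ^ (m\<^sup>2)"
      by (simp add: nonpos power_int_of_nat flip: of_nat_power)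
    have "bilateral_term q c X Y n = inverse c ^ m *
       (q ^ (m\<^sup>2) * (qpoch_inf (X * q powi - int m) q * qpoch_inf (Y * q powi - int m) q))"
      unfolding bilateral_term_def sq unfolding nonpos
      unfolding power_int_minus power_int_of_nat power_inverse by (simp only: mult.assoc)
    also have "\<dots> = (X * Y / (c * q)) ^ m * (A * B)"
    proof -
      have "inverse c ^ m * (X * Y / q) ^ m = (X * Y / (c * q)) ^ m"
        unfolding power_mult_distrib [symmetric] by (simp add: divide_inverse mult_ac)
      then show ?thesis
        unfolding qpoch_inf_powi_uminus[OF q nz(2,3)] A_def B_def
        by (simp only: mult.assoc [symmetric])
    qed
    also have "norm \<dots> = norm (X * Y / (c * q)) ^ m * (norm A * norm B)"
      by (simp only: norm_mult norm_power)
    also have "\<dots> \<le> norm q ^ m * (K * K * (K * K))"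
    proof -
      have "norm (X * Y / (c * q)) \<le> norm q"
        using c(2) nz q by (simp add: norm_mult norm_divide power2_eq_square field_simps)
      then have "norm (X * Y / (c * q)) ^ m \<le> norm q ^ m"
        by (rule power_mono) simp
      moreover have "norm A \<le> K * K"
        unfolding A_def norm_mult using K by (intro mult_mono prod_le R norm_ge_zero) simp
      moreover have "norm B \<le> K * K"
        unfolding B_def norm_mult using K by (intro mult_mono inf_le R norm_ge_zero) simp
      ultimately show ?thesis
        by (rule mult_mono[OF _ mult_mono]) simp_all
    qed
    also have "K * K * (K * K) = K ^ 4"
      by (simp add: power4_eq_xxxx)
    finally show ?thesis
      by (simp add: nonpos mult.commute)
  qed
  then show ?thesis by (simp add: K_def)
qed

lemma summable_bilateral_term:
  assumes "norm q < 1" "q \<noteq> 0" "c \<noteq> 0" "X \<noteq> 0" "Y \<noteq> 0"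
    and "norm c \<le> 1" "norm (X * Y) \<le> norm (c * q\<^sup>2)"
  shows "bilateral_term q c X Y summable_on UNIV"
proof -
  define R where "R = norm X + norm Y + norm (q / X) + norm (q / Y)"
  have R: "norm X \<le> R" "norm Y \<le> R" "norm (q / X) \<le> R" "norm (q / Y) \<le> R"
    by (simp_all add: R_def)
  have "(\<lambda>n. exp (R / (1 - norm q)) ^ 4 * norm q ^ nat \<bar>n\<bar>) summable_on UNIV"
    using assms(1) by (intro summable_on_cmult_right summable_on_power_nat_abs norm_ge_zero)
  then have "(\<lambda>n. norm (bilateral_term q c X Y n)) summable_on UNIV"
    using norm_bilateral_term_le[OF assms R] by (rule Infinite_Sum.abs_summable_on_comparison_test')
  then show ?thesis
    by (rule abs_summable_summable)
qed

text \<open>The bilateral series with the denominators cleared; as functions of \<^term>\<open>x\<close>, both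
  are holomorphic in the punctured plane.\<close>

definition R_num :: "complex \<Rightarrow> complex \<Rightarrow> complex" where
  "R_num x q = (\<Sum>\<^sub>\<infinity>n. bilateral_term q 1 (x * q) (q / x) n)"

definition g3_num :: "complex \<Rightarrow> complex \<Rightarrow> complex" where
  "g3_num x q = (\<Sum>\<^sub>\<infinity>n. bilateral_term q q (x * q) (q\<^sup>2 / x) n)"

text \<open>Brings each term into the form of a cleared term times a constant. Vanishing
  denominators are covered too, since division by zero yields zero.\<close>

lemma divide_quotients: "a / (p / r * (s / t)) = a * (r * t) * inverse (p * s)"
  for a p r s t :: complex
  by (simp add: divide_inverse mult_ac)

lemma R_c_eq: "R_c x q = R_num x q / (qpoch_inf (x * q) q * qpoch_inf (q / x) q)"
proof -
  have "R_c x q = (\<Sum>\<^sub>\<infinity>n. bilateral_term q 1 (x * q) (q / x) n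
      * inverse (qpoch_inf (x * q) q * qpoch_inf (q / x) q))"
    unfolding R_c_def qpoch_def bilateral_term_def divide_quotients by simp
  also have "\<dots> = R_num x q / (qpoch_inf (x * q) q * qpoch_inf (q / x) q)"
    unfolding R_num_def infsum_cmult_left' by (simp add: divide_inverse)
  finally show ?thesis .
qed

text \<open>The index n + 1 in the denominators is absorbed by multiplying both parameters by q,
  which explains the arguments x q and q^2 / x of the cleared series.\<close>

lemma g3_c_eq:
  assumes "q \<noteq> 0"
  shows "g3_c x q = g3_num x q / (qpoch_inf x q * qpoch_inf (q / x) q)"
proof -
  have "q powi (n\<^sup>2 + n) / (qpoch x q (n + 1) * qpoch (q / x) q (n + 1))
      = bilateral_term q q (x * q) (q\<^sup>2 / x) n * inverse (qpoch_inf x q * qpoch_inf (q / x) q)" for n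
  proof -
    have "x * q powi (n + 1) = x * q * q powi n" "q / x * q powi (n + 1) = q\<^sup>2 / x * q powi n"
        "q powi (n\<^sup>2 + n) = q powi n * q powi (n\<^sup>2)"
      using assms by (simp_all add: power_int_add power2_eq_square)
    then show ?thesis
      unfolding qpoch_def bilateral_term_def divide_quotients by (simp only:)
  qed
  then have "g3_c x q = (\<Sum>\<^sub>\<infinity>n. bilateral_term q q (x * q) (q\<^sup>2 / x) n
      * inverse (qpoch_inf x q * qpoch_inf (q / x) q))"
    unfolding g3_c_def by (intro infsum_cong)
  also have "\<dots> = g3_num x q / (qpoch_inf x q * qpoch_inf (q / x) q)"
    unfolding g3_num_def infsum_cmult_left' by (simp add: divide_inverse)
  finally show ?thesis .
qed

section \<open>Symmetry, value at 1 and holomorphy of the cleared series\<close>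

lemma bilateral_term_commute: "bilateral_term q c X Y = bilateral_term q c Y X"
  by (simp add: bilateral_term_def fun_eq_iff mult_ac)

text \<open>Inversion exchanges the parameters x q and q / x, in which the terms are
  symmetric.\<close>

lemma R_num_inverse: "R_num (inverse x) q = R_num x q"
  unfolding R_num_def
  by (subst bilateral_term_commute[of q 1 "x * q"]) (simp add: divide_inverse mult.commute)

text \<open>At x = 1 every term of negative index contains a zero factor, and the remaining
  one-sided sum is that of \<open>qpoch_inf_durfee\<close>.\<close>

lemma R_num_1:
  assumes q: "norm q < 1" "q \<noteq> 0"
  shows "R_num 1 q = qpoch_inf q q"
proof -
  let ?f = "bilateral_term q 1 q q"
  have "?f n = 0" if "n \<notin> range int" for n
  proof (cases n)
    case (nonneg m)
    then show ?thesis using that by blast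
  next
    \<comment> \<open>Here n = -(m + 1), so q q^n = q^(-m), and the factor of index m in its
      infinite product is zero.\<close>
    case n: (neg m)
    have "qpoch_inf (inverse (q ^ m)) q = 0"
    proof (induction m)
      case (Suc m)
      have "inverse (q ^ Suc m) * q = inverse (q ^ m)"
        using q by simp
      then show ?case
        using Suc qpoch_inf_rec[OF q(1), of "inverse (q ^ Suc m)"] by (simp only: mult_zero_right)
    qed (simp add: q)
    moreover have "q * q powi n = inverse (q ^ m)"
      unfolding n power_int_minus power_int_of_nat using q by simp
    ultimately show ?thesis by (simp add: bilateral_term_def)
  qed
  then have "R_num 1 q = infsum ?f (range int)"
    unfolding R_num_def by (intro infsum_cong_neutral) auto
  also have "\<dots> = infsum (\<lambda>n. ?f (int n)) UNIV"
    by (subst infsum_reindex) (auto simp: o_def)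
  also have "\<dots> = (\<Sum>n. ?f (int n))"
  proof -
    have "?f summable_on UNIV"
      using q by (intro summable_bilateral_term) (auto simp: power2_eq_square)
    then have "?f summable_on range int"
      by (rule summable_on_subset_banach) auto
    then have "(\<lambda>n. ?f (int n)) summable_on UNIV"
      by (subst (asm) summable_on_reindex) (auto simp: o_def)
    then show ?thesis
      by (intro sums_unique has_sum_imp_sums has_sum_infsum)
  qed
  also have "\<dots> = (\<Sum>n. q ^ (n\<^sup>2) * (qpoch_inf (q * q ^ n) q)\<^sup>2)"
    unfolding bilateral_term_def of_nat_power[symmetric] power_int_of_nat
    by (simp add: power2_eq_square)
  also have "\<dots> = qpoch_inf q q"
    by (rule qpoch_inf_durfee[OF q(1)])
  finally show ?thesis .
qed

text \<open>The series converges uniformly on closed discs avoiding 0. With X = x q and Y = q / x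
  one has q / X = 1 / x and q / Y = x, so bounds on x and 1 / x supply all that
  \<open>norm_bilateral_term_le\<close> asks for.\<close>

lemma holomorphic_R_num:
  assumes q: "norm q < 1" "q \<noteq> 0"
  shows "(\<lambda>x. R_num x q) holomorphic_on - {0}"
proof -
  have "(\<lambda>x. R_num x q) field_differentiable at z" if z: "z \<noteq> 0" for z
  proof -
    define r where "r = norm z / 2"
    \<comment> \<open>On the disc |z|/2 \<le> |x| \<le> 2|z|, so this sum dominates both |x| and
      |1/x|.\<close>
    define R where "R = 2 * norm z + 2 / norm z"
    have r: "r > 0" using z by (simp add: r_def)
    have nz: "x \<noteq> 0" and bound: "norm x \<le> R" "norm (inverse x) \<le> R" if "x \<in> cball z r" for x
    proof -
      have "norm z \<le> norm x + norm z / 2" "norm x \<le> norm z + norm z / 2"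
        using that norm_triangle_ineq2[of z x] norm_triangle_ineq2[of x z]
        by (simp_all add: r_def dist_norm norm_minus_commute)
      then have *: "norm z / 2 \<le> norm x" "norm x \<le> 2 * norm z"
        by simp_all
      show "x \<noteq> 0" using * z by auto
      show "norm x \<le> R"
        using * z by (simp add: R_def add_increasing2)
      have "inverse (norm x) \<le> inverse (norm z / 2)"
        using * z by (intro le_imp_inverse_le) auto
      then have "norm (inverse x) \<le> 2 / norm z"
        by (simp add: norm_inverse)
      then show "norm (inverse x) \<le> R"
        using norm_ge_zero[of z] unfolding R_def by linarith
    qed
    have q_le: "norm (y * q) \<le> R" if "norm y \<le> R" for y
    proof -
      have "norm (y * q) \<le> norm y * 1"
        unfolding norm_mult using q by (intro mult_left_mono) auto
      then show ?thesis using that by simp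
    qed
    have "uniform_limit (cball z r) (\<lambda>X x. \<Sum>n\<in>X. bilateral_term q 1 (x * q) (q / x) n)
        (\<lambda>x. R_num x q) (finite_subsets_at_top UNIV)"
      unfolding R_num_def
    proof (rule Weierstrass_m_test_general)
      fix n x
      assume "x \<in> cball z r"
      then show "norm (bilateral_term q 1 (x * q) (q / x) n)
          \<le> exp (R / (1 - norm q)) ^ 4 * norm q ^ nat \<bar>n\<bar>"
        using q nz[of x] bound[of x] q_le[of x] q_le[of "inverse x"]
        by (intro norm_bilateral_term_le) (auto simp: field_simps power2_eq_square norm_mult norm_divide)
    next
      show "(\<lambda>n. exp (R / (1 - norm q)) ^ 4 * norm q ^ nat \<bar>n\<bar>) summable_on UNIV"
        using q by (intro summable_on_cmult_right summable_on_power_nat_abs) auto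
    qed
    moreover have "(\<lambda>x. \<Sum>n\<in>X. bilateral_term q 1 (x * q) (q / x) n) holomorphic_on cball z r" for X
      unfolding bilateral_term_def using nz q
      by (intro holomorphic_intros
          holomorphic_on_compose_gen[OF _ holomorphic_qpoch_inf[OF q(1)], unfolded o_def]) auto
    ultimately have "(\<lambda>x. R_num x q) holomorphic_on ball z r"
      by (rule_tac holomorphic_uniform_limit[of z r])
         (auto intro!: always_eventually holomorphic_on_imp_continuous_on
               intro: holomorphic_on_subset[OF _ ball_subset_cball])
    then show ?thesis
      using r by (simp add: holomorphic_on_imp_differentiable_at)
  qed
  then show ?thesis
    by (auto simp: holomorphic_on_def intro: field_differentiable_at_within)
qed

text \<open>The square is the boundary value of a telescoping series: the terms \<open>d n\<close> in the proof tend
  to it, and not to zero, as the index tends to minus infinity.\<close>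
lemma R_num_mult:
  assumes q: "norm q < 1" "q \<noteq> 0" and y: "y \<noteq> 0"
  shows "R_num (y * q) (q\<^sup>2) = q * y * g3_num (y * q) (q\<^sup>2)
           + (qpoch_inf (y * q) (q\<^sup>2) * qpoch_inf (q / y) (q\<^sup>2))\<^sup>2"
proof -
  define Q where "Q = q\<^sup>2"
  have Q: "norm Q < 1" "Q \<noteq> 0"
    using q by (simp_all add: Q_def norm_power power_less_one_iff)
  define P where "P a = qpoch_inf a Q" for a
  define h where "h n = Q powi n" for n
  define p where "p n = Q powi (n\<^sup>2)" for n
  \<comment> \<open>Both parameters carry an extra factor \<open>Q\<close>, so that the two cleared
    series become combinations of the same two sums, of \<open>p n * a n\<close> and of
    \<open>h n * p n * a n\<close>.\<close>
  define a where "a n = P (y * q * Q * h n) * P (q / y * Q * h n)" for n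
  define d where "d n = p n * (P (y * q * h n) * P (q / y * h n))" for n
  have rec: "P z = (1 - z) * P (z * Q)" for z
    unfolding P_def by (rule qpoch_inf_rec[OF Q(1)])
  have C: "(\<lambda>n. p n * a n) summable_on UNIV"
  proof -
    have "bilateral_term Q 1 (y * q * Q) (q / y * Q) summable_on UNIV"
      using q Q y
      by (intro summable_bilateral_term)
         (auto simp: norm_mult norm_divide power2_eq_square Q_def mult_le_one)
    then show ?thesis
      by (simp add: bilateral_term_def [abs_def] p_def a_def h_def P_def)
  qed
  have B: "(\<lambda>n. h n * p n * a n) summable_on UNIV" 
    and g: "g3_num (y * q) Q = (\<Sum>\<^sub>\<infinity>n. h n * p n * a n)"
  proof -
    have eq: "bilateral_term Q Q (y * q * Q) (Q\<^sup>2 / (y * q)) n = h n * p n * a n" for n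
    proof -
      have "Q\<^sup>2 / (y * q) = q / y * Q"
        using q by (simp add: Q_def power2_eq_square)
      then show ?thesis
        by (simp add: bilateral_term_def p_def a_def h_def P_def)
    qed
    show "g3_num (y * q) Q = (\<Sum>\<^sub>\<infinity>n. h n * p n * a n)"
      unfolding g3_num_def eq ..
    have "bilateral_term Q Q (y * q * Q) (Q\<^sup>2 / (y * q)) summable_on UNIV"
      using q Q y
      by (intro summable_bilateral_term)
         (auto simp: norm_mult norm_divide power2_eq_square field_simps)
    then show "(\<lambda>n. h n * p n * a n) summable_on UNIV"
      by (simp add: eq [abs_def])
  qed
  have R: "R_num (y * q) Q = (\<Sum>\<^sub>\<infinity>n. p n * a n) - q / y * (\<Sum>\<^sub>\<infinity>n. h n * p n * a n)"
  proof -
    have "bilateral_term Q 1 (y * q * Q) (Q / (y * q)) n = p n * a n - q / y * (h n * p n * a n)" for n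
    proof -
      have "Q / (y * q) = q / y"
        using q by (simp add: Q_def power2_eq_square)
      moreover have "P (q / y * h n) = (1 - q / y * h n) * P (q / y * Q * h n)"
        using rec[of "q / y * h n"] by (simp add: mult_ac)
      ultimately show ?thesis
        unfolding bilateral_term_def
        by (simp add: p_def a_def flip: P_def h_def) (simp add: algebra_simps)
    qed
    then have "R_num (y * q) Q = (\<Sum>\<^sub>\<infinity>n. p n * a n - q / y * (h n * p n * a n))"
      unfolding R_num_def by (rule infsum_cong)
    also have "\<dots> = (\<Sum>\<^sub>\<infinity>n. p n * a n) - q / y * (\<Sum>\<^sub>\<infinity>n. h n * p n * a n)"
      by (intro infsumI has_sum_diff_cmult has_sum_infsum B C)
    finally show ?thesis .
  qed
  \<comment> \<open>Expanding (1 - y q h)(1 - q h / y) in \<open>d n\<close> gives 1 - q (y + 1/y) h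
    + Q h^2. The quadratic term is exactly \<open>d (n + 1)\<close>, so the difference of
    consecutive \<open>d\<close> is the summand here.\<close>
  have "(\<Sum>\<^sub>\<infinity>n. p n * a n - q * (y + 1 / y) * (h n * p n * a n)) = (P (y * q) * P (q / y))\<^sup>2"
  proof (rule infsum_int_telescope)
    show "(\<lambda>n. p n * a n - q * (y + 1 / y) * (h n * p n * a n)) summable_on UNIV"
      using has_sum_diff_cmult[OF has_sum_infsum[OF C] has_sum_infsum[OF B]]
      by (rule has_sum_imp_summable)
    show "p n * a n - q * (y + 1 / y) * (h n * p n * a n) = d n - d (n + 1)" for n
    proof -
      have h1: "h (n + 1) = Q * h n"
        using Q by (simp add: h_def power_int_add)
      have "(n + 1)\<^sup>2 = n\<^sup>2 + n + n + 1"
        by (simp add: power2_eq_square algebra_simps)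
      then have p1: "p (n + 1) = p n * h n * h n * Q"
        using Q by (simp only: h_def p_def power_int_add simp_thms power_int_1_right)
      have d1: "d (n + 1) = p n * h n * h n * Q * a n"
        unfolding d_def h1 p1 a_def by (simp add: mult_ac)
      have d0: "d n = p n * ((1 - y * q * h n) * (1 - q / y * h n)) * a n"
        unfolding d_def a_def
        using rec[of "y * q * h n"] rec[of "q / y * h n"] by (simp add: mult_ac)
      have "(1 - y * q * h n) * (1 - q / y * h n) = 1 - q * (y + 1 / y) * h n + Q * h n * h n"
        using y by (simp add: Q_def power2_eq_square field_simps)
      then show ?thesis
        unfolding d0 d1 by (simp only:) (simp add: algebra_simps)
    qed
    \<comment> \<open>The parameters y q and q / y have product \<open>Q\<close>, so the power in
      the reflection formula is 1 and the finite products converge to a second copy of the infinite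
      ones.\<close>
    show "(\<lambda>N. d (- int N)) \<longlonglongrightarrow> (P (y * q) * P (q / y))\<^sup>2"
    proof -
      have nz: "y * q \<noteq> 0" "q / y \<noteq> 0" using q y by auto
      have "y * q * (q / y) / Q = 1" "Q / (y * q) = q / y" "Q / (q / y) = y * q"
        using q y by (simp_all add: Q_def power2_eq_square field_simps)
      then have "d (- int N) = ((\<Prod>k<N. 1 - q / y * Q ^ k) * (\<Prod>k<N. 1 - y * q * Q ^ k))
          * (P (y * q) * P (q / y))" for N
        using qpoch_inf_powi_uminus[OF Q nz, of N]
        by (simp add: d_def p_def h_def P_def flip: of_nat_power)
      moreover have "(\<lambda>N. ((\<Prod>k<N. 1 - q / y * Q ^ k) * (\<Prod>k<N. 1 - y * q * Q ^ k)) * (P (y * q) * P (q / y)))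
         \<longlonglongrightarrow> (P (q / y) * P (y * q)) * (P (y * q) * P (q / y))"
        unfolding P_def by (intro tendsto_mult tendsto_const qpoch_inf_LIMSEQ Q)
      ultimately show ?thesis
        by (simp add: power2_eq_square mult_ac)
    qed
    show "(\<lambda>N. d (int N)) \<longlonglongrightarrow> 0"
    proof -
      have Q_lim: "(\<lambda>N. Q ^ N) \<longlonglongrightarrow> 0"
        using Q(1) by (rule LIMSEQ_power_zero)
      then have "(\<lambda>N. Q ^ (N\<^sup>2)) \<longlonglongrightarrow> 0"
        by (rule filterlim_compose) (auto intro!: filterlim_subseq simp: strict_mono_def power_strict_mono)
      then have "(\<lambda>N. Q ^ (N\<^sup>2) * (P (y * q * Q ^ N) * P (q / y * Q ^ N))) 
          \<longlonglongrightarrow> 0 * (P (y * q * 0) * P (q / y * 0))"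
        unfolding P_def using Q_lim Q by (intro tendsto_intros)
      then show ?thesis
        by (simp add: d_def p_def h_def flip: of_nat_power)
    qed
  qed
  moreover have "(\<Sum>\<^sub>\<infinity>n. p n * a n - q * (y + 1 / y) * (h n * p n * a n))
      = (\<Sum>\<^sub>\<infinity>n. p n * a n) - q * (y + 1 / y) * (\<Sum>\<^sub>\<infinity>n. h n * p n * a n)"
    by (intro infsumI has_sum_diff_cmult has_sum_infsum B C)
  ultimately show ?thesis
    unfolding Q_def [symmetric] R g P_def [symmetric] by (simp add: algebra_simps)
qed

text \<open>This is \<open>R_num_mult\<close> at 1/y: both cleared series and the squared product
  are invariant under the inversion of y.\<close>

lemma R_num_divide:
  assumes q: "norm q < 1" "q \<noteq> 0" and y: "y \<noteq> 0"
  shows "R_num (y / q) (q\<^sup>2) = q / y * g3_num (y * q) (q\<^sup>2)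
           + (qpoch_inf (y * q) (q\<^sup>2) * qpoch_inf (q / y) (q\<^sup>2))\<^sup>2"
proof -
  have "R_num (y / q) (q\<^sup>2) = R_num (inverse y * q) (q\<^sup>2)"
    by (subst R_num_inverse [symmetric]) (simp add: field_simps)
  moreover have "g3_num (inverse y * q) (q\<^sup>2) = g3_num (y * q) (q\<^sup>2)"
  proof -
    have "inverse y * q * q\<^sup>2 = (q\<^sup>2)\<^sup>2 / (y * q)" "(q\<^sup>2)\<^sup>2 / (inverse y * q) = y * q * q\<^sup>2"
      using q y by (simp_all add: field_simps power2_eq_square)
    then show ?thesis
      unfolding g3_num_def
      by (subst bilateral_term_commute[of "q\<^sup>2" "q\<^sup>2" "y * q * q\<^sup>2"]) (simp only:)
  qed
  moreover have "q / inverse y = y * q" "inverse y * q = q / y"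
    by (simp_all add: field_simps)
  ultimately show ?thesis
    using R_num_mult[OF q, of "inverse y"] y by (simp add: mult.commute)
qed

subsection \<open>The theta function combination\<close>

text \<open>Powers of q move any nonzero point into the compact annulus |q| \<le> |x| \<le> 1, so
  \<open>f\<close> is bounded. Composition with \<open>exp\<close> removes the puncture and gives a
  bounded entire function.\<close>

lemma holomorphic_q_periodic_constant:
  fixes f :: "complex \<Rightarrow> complex"
  assumes hol: "f holomorphic_on - {0}" and q: "norm q < 1" "q \<noteq> 0"
    and per: "\<And>x. x \<noteq> 0 \<Longrightarrow> f (x * q) = f x" and "x \<noteq> 0"
  shows "f x = f 1"
proof -
  have per_powi: "f (x * q powi n) = f x" if "x \<noteq> 0" for x n
  proof -
    have nat: "f (x * q ^ m) = f x" if "x \<noteq> 0" for x m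
    proof (induction m)
      case (Suc m)
      then show ?case
        using per[of "x * q ^ m"] that q by (simp add: mult_ac)
    qed simp
    show ?thesis
    proof (cases n rule: int_cases2)
      case (nonneg m)
      then show ?thesis using nat that by simp
    next
      case (nonpos m)
      have "x * q powi n * q ^ m = x"
        using q by (simp add: nonpos power_int_minus)
      then show ?thesis
        using nat[of "x * q powi n" m] that q by (metis mult_eq_0_iff power_int_eq_0_iff)
    qed
  qed
  define A where "A = cball (0 :: complex) 1 - ball 0 (norm q)"
  have "compact A"
    unfolding A_def by (intro compact_diff compact_cball open_ball)
  moreover have "A \<subseteq> - {0}"
    using q by (auto simp: A_def)
  then have "continuous_on A f"
    using hol holomorphic_on_imp_continuous_on holomorphic_on_subset by blast
  ultimately have "bounded (f ` A)"
    by (intro compact_imp_bounded compact_continuous_image)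
  moreover have "f x \<in> f ` A" if "x \<noteq> 0" for x
  proof -
    define L where "L = - ln (norm q)"
    have L: "L > 0" using q by (simp add: L_def)
    \<comment> \<open>The least integer n with |x q^n| \<le> 1; minimality gives the lower bound
      |q|.\<close>
    define n where "n = \<lceil>ln (norm x) / L\<rceil>"
    have nz: "norm x * norm q powi n > 0"
      using that q by (simp add: zero_less_power_int)
    have "ln (norm x * norm q powi n) = ln (norm x) - n * L"
      using that q ln_powr[of "norm q" "of_int n"]
      by (simp add: ln_mult zero_less_power_int powr_real_of_int' L_def)
    moreover have "of_int n - 1 < ln (norm x) / L" "ln (norm x) / L \<le> of_int n"
      unfolding n_def by linarith+
    then have "ln (norm x) - n * L \<le> 0" "ln (norm x) - n * L \<ge> - L"
      using L by (simp_all add: field_simps)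
    ultimately have "ln (norm x * norm q powi n) \<le> ln 1" "ln (norm q) \<le> ln (norm x * norm q powi n)"
      by (simp_all add: L_def)
    then have "x * q powi n \<in> A"
      using nz q by (simp add: A_def norm_mult norm_power_int)
    then show ?thesis
      using per_powi[OF that] by (metis imageI)
  qed
  ultimately have "bounded (range (\<lambda>z. f (exp z)))"
    by (auto elim!: bounded_subset)
  moreover have "(f \<circ> exp) holomorphic_on UNIV"
    by (rule holomorphic_on_compose_gen[OF _ hol]) (auto intro: holomorphic_intros)
  ultimately have "(f \<circ> exp) constant_on UNIV"
    by (intro Liouville_theorem) (auto simp: o_def)
  then have "f (exp z) = f (exp w)" for z w
    by (auto simp: constant_on_def)
  from this[of "Ln x" 0] show ?thesis
    using \<open>x \<noteq> 0\<close> by simp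
qed

text \<open>The shift removes the factor 1 - x from the first product and adds 1 - 1/x to the
  second; their quotient is -1/x.\<close>

lemma jtheta_mult_base:
  assumes "norm q < 1" "x \<noteq> 0" "q \<noteq> 0"
  shows "jtheta (x * q) q = - jtheta x q / x"
proof -
  have "qpoch_inf x q = (1 - x) * qpoch_inf (x * q) q"
    by (rule qpoch_inf_rec[OF assms(1)])
  moreover have "qpoch_inf (q / (x * q)) q = (1 - 1 / x) * qpoch_inf (q / x) q"
    using qpoch_inf_rec[OF assms(1), of "1 / x"] assms by simp
  ultimately have "jtheta x q = (1 - x) * qpoch_inf (x * q) q * qpoch_inf (q / x) q * qpoch_inf q q"
    "jtheta (x * q) q = qpoch_inf (x * q) q * ((1 - 1 / x) * qpoch_inf (q / x) q) * qpoch_inf q q"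
    by (simp_all only: jtheta_def)
  then show ?thesis
    using assms(2) by (simp only:) (simp add: field_simps)
qed

text \<open>The second bracket in \<open>N\<close> is q x times the cleared g3 series by
  \<open>R_num_mult\<close>. Writing it through \<open>R_num\<close> reduces the holomorphy of
  \<open>N\<close> to \<open>holomorphic_R_num\<close>.\<close>

lemma theta_combination_constant:
  fixes q :: complex
  assumes q: "norm q < 1" "q \<noteq> 0" and nz: "qpoch_inf (q\<^sup>2) (q\<^sup>2) \<noteq> 0"
  defines "N \<equiv> \<lambda>x. (jtheta (x * q) (q\<^sup>2))\<^sup>2 * R_num x (q\<^sup>2) + (jtheta x (q\<^sup>2) / x)\<^sup>2 *
      (R_num (x * q) (q\<^sup>2) - (qpoch_inf (x * q) (q\<^sup>2) * qpoch_inf (q / x) (q\<^sup>2))\<^sup>2)"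
  assumes "x \<noteq> 0"
  shows "N x = (jtheta q (q\<^sup>2))\<^sup>2 * qpoch_inf (q\<^sup>2) (q\<^sup>2)"
proof -
  define Q where "Q = q\<^sup>2"
  have Q: "norm Q < 1" "Q \<noteq> 0"
    using q by (simp_all add: Q_def norm_power power_less_one_iff)
  define lam where "lam x = (qpoch_inf (x * q) Q * qpoch_inf (q / x) Q)\<^sup>2" for x
  have N: "N x = (jtheta (x * q) Q)\<^sup>2 * R_num x Q + (jtheta x Q / x)\<^sup>2 * (R_num (x * q) Q - lam x)" for x
    by (simp add: N_def Q_def lam_def)
  have lam: "lam x * (qpoch_inf Q Q)\<^sup>2 = (jtheta (x * q) Q)\<^sup>2" if "x \<noteq> 0" for x
  proof -
    have "Q / (x * q) = q / x"
      using q by (simp add: Q_def power2_eq_square)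
    then show ?thesis
      by (simp add: lam_def jtheta_def power_mult_distrib)
  qed
  have per: "N (x * q) = N x" if x: "x \<noteq> 0" for x
  proof -
    define k where "k = qpoch_inf Q Q"
    define t where "t = jtheta x Q"
    define s where "s = jtheta (x * q) Q"
    define G where "G = g3_num (x * q * q) Q"
    have t': "jtheta (x * q * q) Q = - t / x"
      using jtheta_mult_base[OF Q(1) x Q(2)] by (simp add: Q_def t_def power2_eq_square mult.assoc)
    have lams: "lam x * k\<^sup>2 = s\<^sup>2" "lam (x * q) * k\<^sup>2 = (t / x)\<^sup>2"
      using lam[OF x] lam[of "x * q"] x q by (simp_all add: k_def s_def t')
    have "R_num (x * q * q) Q = q * (x * q) * G + lam (x * q)"
      using R_num_mult[OF q, of "x * q"] x q by (simp add: G_def Q_def lam_def)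
    moreover have "R_num x Q = q / (x * q) * G + lam (x * q)"
      using R_num_divide[OF q, of "x * q"] x q by (simp add: G_def Q_def lam_def)
    \<comment> \<open>Eliminates \<open>G\<close> between the two functional equations at x q: the
      brackets are x q^2 \<open>G\<close> and \<open>G\<close> / x.\<close>
    ultimately have R2: "R_num (x * q * q) Q - lam (x * q) = x\<^sup>2 * q\<^sup>2 * (R_num x Q - lam (x * q))"
      using x q by (simp add: power2_eq_square)
    have "s\<^sup>2 * lam (x * q) * k\<^sup>2 = s\<^sup>2 * (t / x)\<^sup>2"
      by (simp only: mult.assoc lams)
    also have "\<dots> = (t / x)\<^sup>2 * lam x * k\<^sup>2"
      by (simp only: mult.assoc lams) (rule mult.commute)
    \<comment> \<open>Under x -> x q the two summands of \<open>N\<close> exchange roles; this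
      equality makes their correction terms agree.\<close>
    finally have eq: "s\<^sup>2 * lam (x * q) = (t / x)\<^sup>2 * lam x"
      using nz by (simp add: k_def Q_def)
    have "N (x * q) = (t / x)\<^sup>2 * R_num (x * q) Q + (s / (x * q))\<^sup>2 * (x\<^sup>2 * q\<^sup>2 * (R_num x Q - lam (x * q)))"
      unfolding N R2 t' by (simp add: s_def power_divide)
    also have "\<dots> = (t / x)\<^sup>2 * R_num (x * q) Q + (s\<^sup>2 * R_num x Q - s\<^sup>2 * lam (x * q))"
      using x q by (simp add: power_divide power_mult_distrib field_simps)
    also have "\<dots> = N x"
      unfolding eq N by (simp add: s_def t_def algebra_simps)
    finally show ?thesis .
  qed
  have "N holomorphic_on - {0}"
  proof -
    note comp = holomorphic_on_compose_gen[OF _ holomorphic_qpoch_inf[OF Q(1)], unfolded o_def]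
    have "(\<lambda>x. R_num (x * q) Q) holomorphic_on - {0}"
      using q by (intro holomorphic_on_compose_gen[OF _ holomorphic_R_num[OF Q], unfolded o_def]
          holomorphic_intros) auto
    then show ?thesis
      unfolding N [abs_def] jtheta_def lam_def using q
      by (intro holomorphic_intros comp holomorphic_R_num[OF Q]) auto
  qed
  then have "N x = N 1"
    using q per \<open>x \<noteq> 0\<close> by (rule holomorphic_q_periodic_constant)
  also have "\<dots> = (jtheta q Q)\<^sup>2 * qpoch_inf Q Q"
  proof -
    have "jtheta 1 Q = 0" using Q by (simp add: jtheta_def)
    then show ?thesis using R_num_1[OF Q] by (simp add: N)
  qed
  finally show ?thesis by (simp add: Q_def)
qed

section \<open>Passage from the constant theta combination to the stated identity\<close>

theorem theorem2p3:
  fixes q x :: complex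
  assumes "norm q < 1" and "q \<noteq> 0" and "x \<noteq> 0"
    and "jtheta x q \<noteq> 0"
  shows "jtheta (x * q) (q\<^sup>2) * R_c x (q\<^sup>2)
           - (1 - inverse x) * q * jtheta x (q\<^sup>2) * g3_c (x * q) (q\<^sup>2)
         = (1 - x) * J 1 q ^ 5 / (J 2 q ^ 2 * jtheta x q)"
proof -
  define P where "P a = qpoch_inf a (q\<^sup>2)" for a
  have q2: "norm (q\<^sup>2) < 1" "q\<^sup>2 \<noteq> 0"
    using assms(1,2) by (simp_all add: norm_power power_less_one_iff)
  define k where "k = P (q\<^sup>2)"
  define w where "w = P q"
  define b where "b = P (x * q\<^sup>2)"
  define p1 where "p1 = P (q\<^sup>2 / x)"
  define p2 where "p2 = P (x * q)"
  define p3 where "p3 = P (q / x)"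
  define E where "E = R_num x (q\<^sup>2)"
  define G where "G = g3_num (x * q) (q\<^sup>2)"
  have p0: "P x = (1 - x) * b"
    unfolding P_def b_def by (rule qpoch_inf_rec[OF q2(1)])
  have split: "qpoch_inf a q = P a * P (a * q)" for a
    unfolding P_def by (rule qpoch_inf_split[OF assms(1)])
  have J1: "qpoch_inf q q = w * k"
    by (simp add: split w_def k_def power2_eq_square)
  have j: "jtheta x q = ((1 - x) * b * p2) * (p3 * p1) * (w * k)"
    unfolding jtheta_def J1
    by (simp add: split p0 p2_def p3_def p1_def power2_eq_square)
  \<comment> \<open>Every product in a denominator below is a factor of \<open>jtheta x q\<close>,
    so its nonvanishing licenses all later cancellations.\<close>
  then have nz: "1 - x \<noteq> 0" "b \<noteq> 0" "p1 \<noteq> 0" "p2 \<noteq> 0" "p3 \<noteq> 0" "w \<noteq> 0" "k \<noteq> 0"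
    using assms(4) by auto
  have cancel: "q\<^sup>2 / (x * q) = q / x" "q\<^sup>2 / q = q"
    using assms(2) by (simp_all add: power2_eq_square)
  have t: "jtheta x (q\<^sup>2) = (1 - x) * b * p1 * k" "jtheta (x * q) (q\<^sup>2) = p2 * p3 * k"
    "jtheta q (q\<^sup>2) = w * w * k"
    unfolding jtheta_def cancel by (simp_all add: p0 p1_def p2_def p3_def k_def w_def flip: P_def)
  have "R_num (x * q) (q\<^sup>2) - (P (x * q) * P (q / x))\<^sup>2 = q * x * G"
    using R_num_mult[OF assms(1-3)] by (simp add: G_def P_def)
  then have comb: "(p2 * p3 * k)\<^sup>2 * E + ((1 - x) * b * p1 * k / x)\<^sup>2 * (q * x * G) = (w * w * k)\<^sup>2 * k"
    using theta_combination_constant[OF assms(1,2) _ assms(3)] nz(7)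
    by (simp add: t E_def k_def flip: P_def)
  have "k\<^sup>2 * ((p2 * p3)\<^sup>2 * E + ((1 - x) * b * p1)\<^sup>2 * q * G / x)
      = (p2 * p3 * k)\<^sup>2 * E + ((1 - x) * b * p1 * k / x)\<^sup>2 * (q * x * G)"
    using assms(3) by (simp add: field_simps power2_eq_square)
  also have "\<dots> = k\<^sup>2 * (w ^ 4 * k)"
    unfolding comb by (simp add: power2_eq_square power4_eq_xxxx)
  finally have "k\<^sup>2 * ((p2 * p3)\<^sup>2 * E + ((1 - x) * b * p1)\<^sup>2 * q * G / x) = k\<^sup>2 * (w ^ 4 * k)" .
  then have key: "(p2 * p3)\<^sup>2 * E + ((1 - x) * b * p1)\<^sup>2 * q * G / x = w ^ 4 * k"
    using nz(7) by simp
  have "jtheta (x * q) (q\<^sup>2) * R_c x (q\<^sup>2) - (1 - inverse x) * q * jtheta x (q\<^sup>2) * g3_c (x * q) (q\<^sup>2)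
      = p2 * p3 * k * (E / (b * p1)) - (1 - inverse x) * q * ((1 - x) * b * p1 * k) * (G / (p2 * p3))"
    unfolding t R_c_eq g3_c_eq[OF q2(2)] cancel
    by (simp add: E_def G_def b_def p1_def p2_def p3_def P_def)
  \<comment> \<open>Uses (1 - 1/x)(1 - x) = -(1 - x)^2 / x, which turns the difference into the sum
    evaluated in \<open>key\<close>.\<close>
  also have "\<dots> = k / (b * p1 * p2 * p3) * ((p2 * p3)\<^sup>2 * E + ((1 - x) * b * p1)\<^sup>2 * q * G / x)"
    using nz assms(3) by (simp add: field_simps power2_eq_square)
  also have "\<dots> = k / (b * p1 * p2 * p3) * (w ^ 4 * k)"
    unfolding key ..
  also have "\<dots> = (1 - x) * (w * k) ^ 5 / (k\<^sup>2 * jtheta x q)"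
    unfolding j using nz by (simp add: field_simps power2_eq_square eval_nat_numeral)
  finally show ?thesis
    by (simp add: J_def J1 k_def P_def)
qed

end
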